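(* Let $T>0$, let $a,c,d\ge 0$ and $b>0$ be constants, let $\Omega\subset\mathbb{R}^n$, $n\le 3$, be a bounded domain with a conforming simplicial mesh $\mathcal{T}_h$, let $k\ge0$ be an integer, and let $$\mathbb{V}_h=P_k(\mathcal{T}_h)^n,\qquad \mathbb{H}_h=P_{k+1}(\mathcal{T}_h)\cap H^1_0(\Omega).$$ Let $(v_h,h_h):[0,T]\to\mathbb{V}_h\times\mathbb{H}_h$ be a discrete solution, i.e. a continuously differentiable function of time with given initial values $v_h(0)=v_{h,0}\in\mathbb{V}_h$, $h_h(0)=h_{h,0}\in\mathbb{H}_h$, such that $$(v_{h,t},w_h)_\Omega+(\nabla h_h,w_h)_\Omega=0,$$ $$((1-ah_h)h_{h,t},q_h)_\Omega-(v_h,\nabla q_h)_\Omega=-b(\nabla h_h,\nabla q_h)_\Omega-(c-d)(v_h\cdot\nabla h_h,q_h)_\Omega+d(h_h,v_h\cdot\nabla q_h)_\Omega$$ for all $w_h\in\mathbb{V}_h$, $q_h\in\mathbb{H}_h$, and all $0\le t\le T$. Then $$\frac{\mathrm{d}}{\mathrm{d}t}\mathcal{H}(v_h,h_h)=-b\,\|\nabla h_h\|_{L^2}^2+(2d-c)\,(v_h\cdot\nabla h_h,h_h)_\Omega .$$ In particular, for $c=2d$ the discrete energy $\mathcal{H}(v_h(t),h_h(t))$ is monotonically decreasing (i.e. non-increasing) over time.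
   Context: $P_k(\mathcal{T}_h)$ is the space of (possibly discontinuous) piecewise polynomials of degree $\le k$ over the mesh $\mathcal{T}_h$ of $\Omega$. The subscript $t$ denotes the time derivative, and $(f,g)_\Omega=\int_\Omega f\,g\,\mathrm{d}x$ is the $L^2(\Omega)$ scalar product (of scalar- or vector-valued functions). The Hamiltonian is $$\mathcal{H}(v,h):=\int_\Omega\tfrac12|v|^2+\tfrac12h^2-\tfrac a3h^3\,\mathrm{d}x .$$ *)

theory Defs
  imports "HOL-Analysis.Analysis"
begin

text \<open>
  Functions on \<open>\<Omega>\<close> are total functions on the ambient space that only matter almost everywhere
  on \<open>\<Omega>\<close>: apart from the test functions, all function spaces below are closed under changing
  a member on a null set.
\<close>

section \<open>The space L2\<close>

definition L2 :: "'a::euclidean_space set \<Rightarrow> ('a \<Rightarrow> 'b::euclidean_space) set" where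
  "L2 \<Omega> = {f \<in> borel_measurable (lebesgue_on \<Omega>). integrable (lebesgue_on \<Omega>) (\<lambda>x. (norm (f x))\<^sup>2)}"

definition L2_inner ::
  "'a::euclidean_space set \<Rightarrow> ('a \<Rightarrow> 'b::euclidean_space) \<Rightarrow> ('a \<Rightarrow> 'b) \<Rightarrow> real" where
  "L2_inner \<Omega> f g = (LINT x|lebesgue_on \<Omega>. f x \<bullet> g x)"

definition L2_norm :: "'a::euclidean_space set \<Rightarrow> ('a \<Rightarrow> 'b::euclidean_space) \<Rightarrow> real" where
  "L2_norm \<Omega> f = sqrt (L2_inner \<Omega> f f)"


section \<open>Sobolev spaces\<close>

definition classical_grad :: "(real^'n \<Rightarrow> real) \<Rightarrow> real^'n \<Rightarrow> real^'n::finite" where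
  "classical_grad f x = (\<chi> i. frechet_derivative f (at x) (axis i 1))"

primrec Ck :: "nat \<Rightarrow> (real^'n::finite \<Rightarrow> real) \<Rightarrow> bool" where
  "Ck 0 f \<longleftrightarrow> continuous_on UNIV f"
| "Ck (Suc m) f \<longleftrightarrow> (\<forall>x. f differentiable (at x)) \<and> (\<forall>i. Ck m (\<lambda>x. classical_grad f x $ i))"

definition test_functions :: "(real^'n::finite) set \<Rightarrow> (real^'n \<Rightarrow> real) set" where
  "test_functions \<Omega> = {\<phi>. (\<forall>m. Ck m \<phi>) \<and>
     compact (closure {x. \<phi> x \<noteq> 0}) \<and> closure {x. \<phi> x \<noteq> 0} \<subseteq> \<Omega>}"

definition is_weak_grad ::
  "(real^'n::finite) set \<Rightarrow> (real^'n \<Rightarrow> real) \<Rightarrow> (real^'n \<Rightarrow> real^'n) \<Rightarrow> bool" where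
  "is_weak_grad \<Omega> f g \<longleftrightarrow> (\<forall>\<phi>\<in>test_functions \<Omega>.
     (LINT x|lebesgue_on \<Omega>. f x *\<^sub>R classical_grad \<phi> x) = - (LINT x|lebesgue_on \<Omega>. \<phi> x *\<^sub>R g x))"

definition H1 :: "(real^'n::finite) set \<Rightarrow> (real^'n \<Rightarrow> real) set" where
  "H1 \<Omega> = {f \<in> L2 \<Omega>. \<exists>g \<in> L2 \<Omega>. is_weak_grad \<Omega> f g}"

text \<open>The weak gradient is determined up to a null set; one representative is chosen.\<close>

definition weak_grad ::
  "(real^'n::finite) set \<Rightarrow> (real^'n \<Rightarrow> real) \<Rightarrow> real^'n \<Rightarrow> real^'n" where
  "weak_grad \<Omega> f = (SOME g. g \<in> L2 \<Omega> \<and> is_weak_grad \<Omega> f g)"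

text \<open>Closure of the test functions in the H1 norm.\<close>

definition H10 :: "(real^'n::finite) set \<Rightarrow> (real^'n \<Rightarrow> real) set" where
  "H10 \<Omega> = {f \<in> H1 \<Omega>. \<exists>\<phi> :: nat \<Rightarrow> real^'n \<Rightarrow> real.
     (\<forall>m. \<phi> m \<in> test_functions \<Omega>) \<and>
     (\<lambda>m. L2_norm \<Omega> (\<lambda>x. \<phi> m x - f x)) \<longlonglongrightarrow> 0 \<and>
     (\<lambda>m. L2_norm \<Omega> (\<lambda>x. classical_grad (\<phi> m) x - weak_grad \<Omega> f x)) \<longlonglongrightarrow> 0}"


section \<open>Meshes and finite element spaces\<close>

text \<open>
  The conformity condition, that any two elements meet in a common face (possibly empty), is part
  of \<^const>\<open>triangulation\<close>.
\<close>

definition conforming_simplicial_mesh ::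
  "'a::euclidean_space set \<Rightarrow> 'a set set \<Rightarrow> bool" where
  "conforming_simplicial_mesh \<Omega> \<T> \<longleftrightarrow>
     triangulation \<T> \<and> (\<forall>K\<in>\<T>. int DIM('a) simplex K) \<and> \<Union>\<T> = closure \<Omega>"

definition polys :: "nat \<Rightarrow> (real^'n::finite \<Rightarrow> real) set" where
  "polys k = {p. \<exists>c :: ('n \<Rightarrow> nat) \<Rightarrow> real.
     p = (\<lambda>x. \<Sum>\<alpha> | sum \<alpha> UNIV \<le> k. c \<alpha> * (\<Prod>i\<in>UNIV. x $ i ^ \<alpha> i))}"

lemma finite_multi_indices: "finite {\<alpha> :: 'n::finite \<Rightarrow> nat. sum \<alpha> UNIV \<le> k}"
proof (rule finite_subset)
  show "{\<alpha> :: 'n \<Rightarrow> nat. sum \<alpha> UNIV \<le> k} \<subseteq> UNIV \<rightarrow>\<^sub>E {..k}"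
  proof
    fix \<alpha> :: "'n \<Rightarrow> nat"
    assume "\<alpha> \<in> {\<alpha>. sum \<alpha> UNIV \<le> k}"
    then have "\<alpha> i \<le> k" for i
      using member_le_sum[of i UNIV \<alpha>] by simp
    then show "\<alpha> \<in> UNIV \<rightarrow>\<^sub>E {..k}"
      by (simp add: PiE_def)
  qed
  show "finite ((UNIV :: 'n set) \<rightarrow>\<^sub>E {..k})"
    by (rule finite_PiE) simp_all
qed

text \<open>
  Since members only matter almost everywhere, values on the element boundaries are irrelevant
  and no continuity across them is imposed.
\<close>

definition broken_polys ::
  "(real^'n::finite) set \<Rightarrow> (real^'n) set set \<Rightarrow> nat \<Rightarrow> (real^'n \<Rightarrow> real) set" where
  "broken_polys \<Omega> \<T> k =
     {f. \<forall>K\<in>\<T>. \<exists>p\<in>polys k. AE x in lebesgue_on (K \<inter> \<Omega>). f x = p x}"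

definition Vh ::
  "(real^'n::finite) set \<Rightarrow> (real^'n) set set \<Rightarrow> nat \<Rightarrow> (real^'n \<Rightarrow> real^'n) set" where
  "Vh \<Omega> \<T> k = {w. \<forall>i. (\<lambda>x. w x $ i) \<in> broken_polys \<Omega> \<T> k}"

definition Hh ::
  "(real^'n::finite) set \<Rightarrow> (real^'n) set set \<Rightarrow> nat \<Rightarrow> (real^'n \<Rightarrow> real) set" where
  "Hh \<Omega> \<T> k = broken_polys \<Omega> \<T> (k + 1) \<inter> H10 \<Omega>"


section \<open>Time derivatives\<close>

text \<open>
  \<open>u\<close> is continuously differentiable on \<open>[0, T]\<close>, one-sidedly at the end points, as a map into
  the space \<open>X\<close>, with derivative \<open>u'\<close>. Limits are taken in the L2 norm; in the finite-dimensional
  spaces \<open>X\<close> of interest all norms are equivalent.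
\<close>

definition has_C1_derivative ::
  "'a::euclidean_space set \<Rightarrow> real \<Rightarrow> ('a \<Rightarrow> 'b::euclidean_space) set \<Rightarrow>
   (real \<Rightarrow> 'a \<Rightarrow> 'b) \<Rightarrow> (real \<Rightarrow> 'a \<Rightarrow> 'b) \<Rightarrow> bool" where
  "has_C1_derivative \<Omega> T X u u' \<longleftrightarrow> (\<forall>t\<in>{0..T}. u t \<in> X \<and> u' t \<in> X \<and>
     ((\<lambda>s. L2_norm \<Omega> (\<lambda>x. (u s x - u t x) /\<^sub>R (s - t) - u' t x)) \<longlongrightarrow> 0) (at t within {0..T}) \<and>
     ((\<lambda>s. L2_norm \<Omega> (\<lambda>x. u' s x - u' t x)) \<longlongrightarrow> 0) (at t within {0..T}))"


section \<open>The Hamiltonian\<close>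

definition Hamiltonian ::
  "(real^'n::finite) set \<Rightarrow> real \<Rightarrow> (real^'n \<Rightarrow> real^'n) \<Rightarrow> (real^'n \<Rightarrow> real) \<Rightarrow> real" where
  "Hamiltonian \<Omega> a v h =
     (LINT x|lebesgue_on \<Omega>. 1/2 * (norm (v x))\<^sup>2 + 1/2 * (h x)\<^sup>2 - a/3 * (h x)^3)"

end

theory Submission
  imports Defs
begin

text \<open>
  Testing the first equation with \<open>w = v\<close> and the second with \<open>q = h\<close> and adding them, the terms
  \<open>(\<nabla>h, v)\<close> cancel, and the left-hand side becomes \<open>(v', v) + ((1 - a h) h', h)\<close>, which is the time
  derivative of the Hamiltonian. To differentiate under the integral, and in particular to control
  the cubic term although the time derivatives are taken in L2 only, one uses that piecewise
  polynomials of bounded degree form, up to null sets, a finite-dimensional space, on which the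
  essential supremum is bounded by the L2 norm: difference quotients then converge essentially
  uniformly.
\<close>

section \<open>Essentially bounded functions\<close>

text \<open>Only the existence of a bound is recorded, so no norm is formed; later estimates carry
  explicit almost-everywhere bounds. Over a finite measure, membership together with closure under
  ring operations settles every integrability question below.\<close>

definition Linf :: "'a measure \<Rightarrow> ('a \<Rightarrow> real) set" where
  "Linf M = {f \<in> borel_measurable M. \<exists>B. AE x in M. \<bar>f x\<bar> \<le> B}"

section \<open>Algebra and integrability of essentially bounded functions\<close>

lemma LinfI: "f \<in> borel_measurable M \<Longrightarrow> AE x in M. \<bar>f x\<bar> \<le> B \<Longrightarrow> f \<in> Linf M"
  unfolding Linf_def by blast

lemma Linf_measurable: "f \<in> Linf M \<Longrightarrow> f \<in> borel_measurable M"
  unfolding Linf_def by blast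

lemma LinfE:
  assumes "f \<in> Linf M"
  obtains B where "B \<ge> 0" "AE x in M. \<bar>f x\<bar> \<le> B"
proof -
  obtain B where "AE x in M. \<bar>f x\<bar> \<le> B"
    using assms unfolding Linf_def by blast
  then have "AE x in M. \<bar>f x\<bar> \<le> max B 0"
    by eventually_elim auto
  then show ?thesis
    using that[of "max B 0"] by simp
qed

lemma Linf_const: "(\<lambda>x. c) \<in> Linf M"
  by (rule LinfI[where B = "\<bar>c\<bar>"]) auto

lemma Linf_add:
  assumes f: "f \<in> Linf M" and g: "g \<in> Linf M"
  shows "(\<lambda>x. f x + g x) \<in> Linf M"
proof -
  obtain B C where "AE x in M. \<bar>f x\<bar> \<le> B" "AE x in M. \<bar>g x\<bar> \<le> C"
    using f g by (metis LinfE)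
  then have "AE x in M. \<bar>f x + g x\<bar> \<le> B + C"
    by eventually_elim auto
  then show ?thesis
    using Linf_measurable[OF f] Linf_measurable[OF g] by (intro LinfI) auto
qed

lemma Linf_mult:
  assumes f: "f \<in> Linf M" and g: "g \<in> Linf M"
  shows "(\<lambda>x. f x * g x) \<in> Linf M"
proof -
  obtain B C where B: "AE x in M. \<bar>f x\<bar> \<le> B" and C: "AE x in M. \<bar>g x\<bar> \<le> C" and "B \<ge> 0"
    using f g by (metis LinfE)
  from B C have "AE x in M. \<bar>f x * g x\<bar> \<le> B * C"
    by eventually_elim (simp add: abs_mult mult_mono' \<open>B \<ge> 0\<close>)
  then show ?thesis
    using Linf_measurable[OF f] Linf_measurable[OF g] by (intro LinfI) auto
qed

lemma Linf_diff:
  assumes f: "f \<in> Linf M" and g: "g \<in> Linf M"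
  shows "(\<lambda>x. f x - g x) \<in> Linf M"
  using Linf_add[OF f Linf_mult[OF Linf_const[of "-1"] g]] by simp

lemma Linf_sum: "(\<And>i. i \<in> I \<Longrightarrow> f i \<in> Linf M) \<Longrightarrow> (\<lambda>x. \<Sum>i\<in>I. f i x) \<in> Linf M"
  by (induction I rule: infinite_finite_induct) (auto intro: Linf_add Linf_const)

lemma Linf_abs: "f \<in> Linf M \<Longrightarrow> (\<lambda>x. \<bar>f x\<bar>) \<in> Linf M"
  unfolding Linf_def by auto

lemmas Linf_intros = Linf_const Linf_add Linf_mult Linf_diff Linf_sum Linf_abs

lemma (in finite_measure) integrable_Linf:
  assumes "f \<in> Linf M"
  shows "integrable M f"
proof -
  obtain B where "AE x in M. norm (f x) \<le> B"
    using assms unfolding real_norm_def by (rule LinfE)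
  then show ?thesis
    using integrable_const_bound Linf_measurable[OF assms] by blast
qed

text \<open>A Cauchy-Schwarz estimate with a cruder constant: for \<open>l > 0\<close> the pointwise
  bound of |y| by y^2/l + l is integrated, and for \<open>l = 0\<close> the function vanishes almost
  everywhere. Using a majorant \<open>l\<close> of the L2 norm avoids square roots.\<close>

lemma (in finite_measure) integral_abs_le_L2:
  assumes f: "f \<in> Linf M" and "l \<ge> 0" and l: "(LINT x|M. (f x)\<^sup>2) \<le> l\<^sup>2"
  shows "(LINT x|M. \<bar>f x\<bar>) \<le> (1 + measure M (space M)) * l"
proof -
  have f2: "(\<lambda>x. (f x)\<^sup>2) \<in> Linf M"
    unfolding power2_eq_square by (intro Linf_intros f)
  show ?thesis
  proof (cases "l = 0")
    case True
    then have "(LINT x|M. (f x)\<^sup>2) = 0"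
      using l by (simp add: order_antisym)
    then have "AE x in M. (f x)\<^sup>2 = 0"
      using integral_nonneg_eq_0_iff_AE[OF integrable_Linf[OF f2]] by simp
    then have "(LINT x|M. \<bar>f x\<bar>) = 0"
      by (intro integral_eq_zero_AE) simp
    then show ?thesis
      using \<open>l = 0\<close> by simp
  next
    case False
    then have "l > 0"
      using \<open>l \<ge> 0\<close> by simp
    have "\<bar>y\<bar> \<le> y\<^sup>2 / l + l" for y
    proof -
      have "\<bar>y\<bar> * l \<le> y\<^sup>2 + l\<^sup>2"
        using sum_squares_bound[of "\<bar>y\<bar>" l] mult_nonneg_nonneg[of "\<bar>y\<bar>" l] \<open>l > 0\<close>
        unfolding mult.assoc power2_abs by linarith
      then show ?thesis
        using \<open>l > 0\<close> by (simp add: field_simps power2_eq_square)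
    qed
    then have "(LINT x|M. \<bar>f x\<bar>) \<le> (LINT x|M. (f x)\<^sup>2 / l + l)"
      unfolding divide_inverse by (intro integral_mono integrable_Linf Linf_intros f f2)
    also have "\<dots> = (LINT x|M. (f x)\<^sup>2) / l + measure M (space M) * l"
      using integrable_Linf[OF f2] by simp
    also have "\<dots> \<le> l\<^sup>2 / l + measure M (space M) * l"
      using l \<open>l > 0\<close> by (intro add_right_mono divide_right_mono) auto
    finally show ?thesis
      using \<open>l > 0\<close> by (simp add: power2_eq_square algebra_simps)
  qed
qed

section \<open>Equivalence of norms on finite-dimensional spaces of functions\<close>

lemma integral_diff_sum:
  fixes u :: "'a \<Rightarrow> real"
  assumes "integrable M u" and w: "\<And>j. j \<in> J \<Longrightarrow> integrable M (w j)"
  shows "(LINT x|M. u x - (\<Sum>j\<in>J. c j * w j x)) = (LINT x|M. u x) - (\<Sum>j\<in>J. c j * (LINT x|M. w j x))"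
proof -
  have cw: "integrable M (\<lambda>x. c j * w j x)" if "j \<in> J" for j
    using w[OF that] by simp
  have "(LINT x|M. u x - (\<Sum>j\<in>J. c j * w j x)) = (LINT x|M. u x) - (\<Sum>j\<in>J. LINT x|M. c j * w j x)"
    using assms(1) cw
    by (simp add: Bochner_Integration.integral_diff Bochner_Integration.integral_sum
        del: Bochner_Integration.integral_mult_right_zero)
  then show ?thesis
    by simp
qed

text \<open>The pairs \<open>g j\<close>, \<open>e j\<close> replace a basis with its coordinate
  functionals, modulo null sets, without selecting independent elements of \<open>A\<close>. The
  induction resembles Gram-Schmidt: the residual of a new function under the expansion
  \<open>P\<close> built so far either vanishes almost everywhere, or is adjoined with a functional
  that detects it.\<close>

lemma (in finite_measure) ex_dual_system:
  assumes "finite A" and "A \<subseteq> Linf M"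
  shows "\<exists>(n::nat) g e. (\<forall>j<n. g j \<in> Linf M \<and> e j \<in> Linf M) \<and>
    (\<forall>f\<in>A. AE x in M. f x = (\<Sum>j<n. (LINT y|M. f y * g j y) * e j x))"
  using assms
proof (induction A)
  case empty
  then show ?case by auto
next
  case (insert f A)
  then have "A \<subseteq> Linf M"
    by blast
  from insert.IH[OF this] obtain n :: nat and g e where ge: "\<And>j. j < n \<Longrightarrow> g j \<in> Linf M" "\<And>j. j < n \<Longrightarrow> e j \<in> Linf M"
    and A: "\<And>f. f \<in> A \<Longrightarrow> AE x in M. f x = (\<Sum>j<n. (LINT y|M. f y * g j y) * e j x)"
    by blast
  have f: "f \<in> Linf M" and AL: "\<And>p. p \<in> A \<Longrightarrow> p \<in> Linf M"
    using insert.prems by auto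
  define P where "P p x = (\<Sum>j<n. (LINT y|M. p y * g j y) * e j x)" for p x
  have P: "P p \<in> Linf M" for p
    unfolding P_def by (intro Linf_intros) (auto intro: ge)
  define r where "r x = f x - P f x" for x
  have r: "r \<in> Linf M"
    unfolding r_def by (intro Linf_intros f P)
  \<comment> \<open>The squared L2 norm of the residual decides whether \<open>f\<close> is already
    reproduced by the present system.\<close>
  define N where "N = (LINT x|M. r x * r x)"
  show ?case
  proof (cases "N = 0")
    case True
    then have "AE x in M. r x * r x = 0"
      unfolding N_def
      using integral_nonneg_eq_0_iff_AE[OF integrable_Linf[OF Linf_mult[OF r r]]] by simp
    then have "AE x in M. f x = P f x"
      by eventually_elim (simp add: r_def)
    then show ?thesis
      using ge A unfolding P_def by (intro exI[of _ n] exI[of _ g] exI[of _ e]) auto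
  next
    case False
    \<comment> \<open>The new coordinate of \<open>p\<close> should be the inner product of
      \<open>p - P p\<close> with \<open>r\<close>, normalised by \<open>N\<close>. Moving
      \<open>P\<close> to the other side of the pairing gives \<open>s\<close>: the subtracted sum
      is the transpose of \<open>P\<close> applied to \<open>r\<close>.\<close>
    define s where "s x = (r x - (\<Sum>j<n. (LINT y|M. e j y * r y) * g j x)) / N" for x
    have s: "s \<in> Linf M"
      unfolding s_def divide_inverse by (intro Linf_intros r) (auto intro: ge)
    text \<open>The functional represented by \<open>s\<close> vanishes on \<open>A\<close> and takes the value 1 at \<open>f\<close>.\<close>
    have ps: "(LINT x|M. p x * s x) = (LINT x|M. (p x - P p x) * r x) / N" if p: "p \<in> Linf M" for p
    proof -
      have "(LINT x|M. p x * s x) =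
          (LINT x|M. (p x * r x - (\<Sum>j<n. (LINT y|M. e j y * r y) * (p x * g j x))) / N)"
        by (intro Bochner_Integration.integral_cong)
          (auto simp: s_def algebra_simps sum_distrib_left)
      also have "\<dots> = (LINT x|M. p x * r x - (\<Sum>j<n. (LINT y|M. e j y * r y) * (p x * g j x))) / N"
        by simp
      also have "\<dots> = ((LINT x|M. p x * r x)
          - (\<Sum>j<n. (LINT y|M. e j y * r y) * (LINT x|M. p x * g j x))) / N"
        by (subst integral_diff_sum) (auto intro!: integrable_Linf Linf_intros p r ge)
      also have "\<dots> = ((LINT x|M. p x * r x)
          - (\<Sum>j<n. (LINT y|M. p y * g j y) * (LINT x|M. e j x * r x))) / N"
        by (simp add: mult.commute)
      also have "\<dots> = (LINT x|M. p x * r x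
          - (\<Sum>j<n. (LINT y|M. p y * g j y) * (e j x * r x))) / N"
        by (subst integral_diff_sum) (auto intro!: integrable_Linf Linf_intros p r ge)
      also have "\<dots> = (LINT x|M. (p x - P p x) * r x) / N"
        by (simp add: P_def left_diff_distrib sum_distrib_right mult.assoc)
      finally show ?thesis .
    qed
    define g' where "g' = g(n := s)"
    define e' where "e' = e(n := r)"
    have split: "(\<Sum>j<Suc n. (LINT y|M. p y * g' j y) * e' j x)
        = P p x + (LINT y|M. p y * s y) * r x" for p x
      by (simp add: g'_def e'_def P_def)
    have "AE x in M. p x = (\<Sum>j<Suc n. (LINT y|M. p y * g' j y) * e' j x)" if p: "p \<in> A" for p
    proof -
      have pP: "AE x in M. p x = P p x"
        using A[OF p] by (simp add: P_def)
      then have "AE x in M. (p x - P p x) * r x = 0"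
        by eventually_elim simp
      then have "(LINT x|M. p x * s x) = 0"
        by (simp add: ps[OF AL[OF p]] integral_eq_zero_AE)
      then show ?thesis
        using pP by (simp only: split) simp
    qed
    moreover have "AE x in M. f x = (\<Sum>j<Suc n. (LINT y|M. f y * g' j y) * e' j x)"
    proof -
      have "(LINT x|M. f x * s x) = 1"
        using False by (simp add: ps[OF f] N_def r_def)
      then show ?thesis
        by (simp only: split) (simp add: r_def)
    qed
    moreover have "\<forall>j<Suc n. g' j \<in> Linf M \<and> e' j \<in> Linf M"
      using ge r s by (auto simp: g'_def e'_def less_Suc_eq)
    ultimately show ?thesis
      by (intro exI[of _ "Suc n"] exI[of _ g'] exI[of _ e']) auto
  qed
qed

text \<open>The coefficients \<open>c\<close> cannot be bounded, since the \<open>b i\<close> may be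
  dependent modulo null sets. The coordinates in a dual system can: each is an integral of the
  combination against a bounded \<open>g j\<close>, hence at most a constant times the L1 norm.
  Multiplying by the bounds of the \<open>e j\<close> and summing gives \<open>C\<close>.\<close>

lemma (in finite_measure) span_Linf_le_L1:
  assumes "finite A" and b: "\<And>i. i \<in> A \<Longrightarrow> b i \<in> Linf M"
  shows "\<exists>C\<ge>0. \<forall>c. AE x in M. \<bar>\<Sum>i\<in>A. c i * b i x\<bar> \<le> C * (LINT y|M. \<bar>\<Sum>i\<in>A. c i * b i y\<bar>)"
proof -
  obtain n :: nat and g e where ge: "\<And>j. j < n \<Longrightarrow> g j \<in> Linf M" "\<And>j. j < n \<Longrightarrow> e j \<in> Linf M"
    and A: "\<And>f. f \<in> b ` A \<Longrightarrow> AE x in M. f x = (\<Sum>j<n. (LINT y|M. f y * g j y) * e j x)"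
    using ex_dual_system[OF finite_imageI[OF \<open>finite A\<close>] image_subsetI[of A b, OF b]] by blast
  have "\<exists>G\<ge>0. AE x in M. \<bar>g j x\<bar> \<le> G" if "j < n" for j
    using ge(1)[OF that] by (rule LinfE) blast
  then obtain G where G: "\<And>j. j < n \<Longrightarrow> G j \<ge> 0" "\<And>j. j < n \<Longrightarrow> AE x in M. \<bar>g j x\<bar> \<le> G j"
    by metis
  have "\<exists>E\<ge>0. AE x in M. \<bar>e j x\<bar> \<le> E" if "j < n" for j
    using ge(2)[OF that] by (rule LinfE) blast
  then obtain E where E: "\<And>j. j < n \<Longrightarrow> E j \<ge> 0" "\<And>j. j < n \<Longrightarrow> AE x in M. \<bar>e j x\<bar> \<le> E j"
    by metis
  have "AE x in M. \<bar>\<Sum>i\<in>A. c i * b i x\<bar>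
      \<le> (\<Sum>j<n. G j * E j) * (LINT y|M. \<bar>\<Sum>i\<in>A. c i * b i y\<bar>)" for c
  proof -
    define p where "p x = (\<Sum>i\<in>A. c i * b i x)" for x
    define I where "I = (LINT y|M. \<bar>p y\<bar>)"
    have p: "p \<in> Linf M"
      unfolding p_def by (intro Linf_intros b)
    have pg: "\<bar>LINT y|M. p y * g j y\<bar> \<le> G j * I" if j: "j < n" for j
    proof -
      have "\<bar>LINT y|M. p y * g j y\<bar> \<le> (LINT y|M. \<bar>p y * g j y\<bar>)"
        using integral_norm_bound[of M "\<lambda>y. p y * g j y"] by simp
      also have "\<dots> \<le> (LINT y|M. G j * \<bar>p y\<bar>)"
      proof (rule integral_mono_AE)
        show "AE y in M. \<bar>p y * g j y\<bar> \<le> G j * \<bar>p y\<bar>"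
          using G(2)[OF j]
          by eventually_elim (metis abs_ge_zero abs_mult mult.commute mult_right_mono)
      qed (intro integrable_Linf Linf_intros p ge j)+
      finally show ?thesis
        by (simp add: I_def)
    qed
    \<comment> \<open>The expansion is known for the generators only, each off its own null set.
      Finiteness of \<open>A\<close> yields a common null set, and linearity of the coordinates then
      carries the expansion over to \<open>p\<close>.\<close>
    have "AE x in M. \<forall>i\<in>A. b i x = (\<Sum>j<n. (LINT y|M. b i y * g j y) * e j x)"
      using \<open>finite A\<close> A by (intro AE_finite_allI) auto
    moreover have "AE x in M. \<forall>j\<in>{..<n}. \<bar>e j x\<bar> \<le> E j"
      using E by (intro AE_finite_allI) auto
    ultimately have "AE x in M. \<bar>p x\<bar> \<le> (\<Sum>j<n. G j * E j) * I"
    proof eventually_elim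
      case (elim x)
      have "p x = (\<Sum>i\<in>A. \<Sum>j<n. (LINT y|M. c i * (b i y * g j y)) * e j x)"
        using elim by (simp add: p_def sum_distrib_left mult.assoc)
      also have "\<dots> = (\<Sum>j<n. (\<Sum>i\<in>A. LINT y|M. c i * (b i y * g j y)) * e j x)"
        by (subst sum.swap) (simp add: sum_distrib_right)
      also have "\<dots> = (\<Sum>j<n. (LINT y|M. p y * g j y) * e j x)"
      proof (intro sum.cong refl arg_cong2[where f = "(*)"])
        fix j assume "j \<in> {..<n}"
        then have "integrable M (\<lambda>y. c i * (b i y * g j y))" if "i \<in> A" for i
          using that by (intro integrable_Linf Linf_intros b ge) auto
        then have "(\<Sum>i\<in>A. LINT y|M. c i * (b i y * g j y))
            = (LINT y|M. (\<Sum>i\<in>A. c i * (b i y * g j y)))"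
          by (rule Bochner_Integration.integral_sum[symmetric])
        then show "(\<Sum>i\<in>A. LINT y|M. c i * (b i y * g j y)) = (LINT y|M. p y * g j y)"
          by (simp add: p_def sum_distrib_right mult.assoc)
      qed
      finally have "\<bar>p x\<bar> \<le> (\<Sum>j<n. \<bar>LINT y|M. p y * g j y\<bar> * \<bar>e j x\<bar>)"
        using sum_abs[of "\<lambda>j. (LINT y|M. p y * g j y) * e j x" "{..<n}"] by (simp add: abs_mult)
      also have "\<dots> \<le> (\<Sum>j<n. (G j * I) * E j)"
        using pg elim G by (intro sum_mono mult_mono) (auto simp: I_def)
      finally show ?case
        by (simp add: sum_distrib_right sum_distrib_left mult_ac)
    qed
    then show ?thesis
      by (simp add: p_def I_def)
  qed
  moreover have "(\<Sum>j<n. G j * E j) \<ge> 0"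
    using G E by (intro sum_nonneg) auto
  ultimately show ?thesis
    by blast
qed

section \<open>Piecewise polynomials\<close>

lemma polys_lincomb:
  assumes "p \<in> polys k" "q \<in> polys k"
  shows "(\<lambda>x. r * p x + s * q x) \<in> polys k"
proof -
  obtain c d where "p = (\<lambda>x. \<Sum>\<alpha> | sum \<alpha> UNIV \<le> k. c \<alpha> * (\<Prod>i\<in>UNIV. x $ i ^ \<alpha> i))"
    "q = (\<lambda>x. \<Sum>\<alpha> | sum \<alpha> UNIV \<le> k. d \<alpha> * (\<Prod>i\<in>UNIV. x $ i ^ \<alpha> i))"
    using assms unfolding polys_def by blast
  then have "(\<lambda>x. r * p x + s * q x) =
      (\<lambda>x. \<Sum>\<alpha> | sum \<alpha> UNIV \<le> k. (r * c \<alpha> + s * d \<alpha>) * (\<Prod>i\<in>UNIV. x $ i ^ \<alpha> i))"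
    by (simp add: sum_distrib_left sum.distrib[symmetric] algebra_simps)
  then show ?thesis
    unfolding polys_def mem_Collect_eq by (intro exI[of _ "\<lambda>\<alpha>. r * c \<alpha> + s * d \<alpha>"])
qed

text \<open>Keeps the errors of difference quotients inside the finite element space, where the
  inverse inequality applies to them.\<close>

lemma broken_polys_lincomb:
  assumes f: "f \<in> broken_polys \<Omega> \<T> k" and g: "g \<in> broken_polys \<Omega> \<T> k"
  shows "(\<lambda>x. r * f x + s * g x) \<in> broken_polys \<Omega> \<T> k"
  unfolding broken_polys_def
proof (intro CollectI ballI)
  fix K assume "K \<in> \<T>"
  then obtain p q where pq: "p \<in> polys k" "q \<in> polys k"
    and eq: "AE x in lebesgue_on (K \<inter> \<Omega>). f x = p x" "AE x in lebesgue_on (K \<inter> \<Omega>). g x = q x"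
    using f g unfolding broken_polys_def by blast
  have "AE x in lebesgue_on (K \<inter> \<Omega>). r * f x + s * g x = r * p x + s * q x"
    using eq by eventually_elim simp
  then show "\<exists>p\<in>polys k. AE x in lebesgue_on (K \<inter> \<Omega>). r * f x + s * g x = p x"
    by (intro bexI[of _ "\<lambda>x. r * p x + s * q x"] polys_lincomb pq)
qed

lemma continuous_Linf_lebesgue_on:
  fixes f :: "'a::euclidean_space \<Rightarrow> real"
  assumes "continuous_on UNIV f" "bounded S" "S \<in> sets lebesgue"
  shows "f \<in> Linf (lebesgue_on S)"
proof -
  have "compact (f ` closure S)"
    using assms by (intro compact_continuous_image) (auto intro: continuous_on_subset)
  then have "bounded (f ` closure S)"
    by (rule compact_imp_bounded)
  then obtain B where B: "\<forall>y\<in>f ` closure S. norm y \<le> B"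
    unfolding bounded_iff by (rule exE)
  have "\<bar>f x\<bar> \<le> B" if "x \<in> S" for x
    using B that closure_subset[of S] by auto
  then have "AE x in lebesgue_on S. \<bar>f x\<bar> \<le> B"
    by (intro AE_I2) simp
  moreover have "f \<in> borel_measurable (lebesgue_on S)"
    using assms by (intro continuous_imp_measurable_on_sets_lebesgue) (auto intro: continuous_on_subset)
  ultimately show ?thesis
    by (rule LinfI[rotated])
qed

lemma polys_Linf:
  fixes p :: "real^'n::finite \<Rightarrow> real"
  assumes "p \<in> polys k" "bounded S" "S \<in> sets lebesgue"
  shows "p \<in> Linf (lebesgue_on S)"
proof -
  have "continuous_on UNIV p"
    using assms(1) unfolding polys_def by (auto intro!: continuous_intros)
  then show ?thesis
    using assms by (intro continuous_Linf_lebesgue_on)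
qed

text \<open>Polynomials of degree at most \<open>k\<close> are the span of finitely many monomials,
  each bounded on \<open>S\<close>. The degenerate case of a null set \<open>S\<close>, where the
  monomials are dependent modulo null sets, is covered too.\<close>

lemma polys_le_L1:
  fixes S :: "(real^'n::finite) set"
  assumes "bounded S" "S \<in> sets lebesgue"
  shows "\<exists>C\<ge>0. \<forall>p\<in>polys k. AE x in lebesgue_on S. \<bar>p x\<bar> \<le> C * (LINT y|lebesgue_on S. \<bar>p y\<bar>)"
proof -
  interpret finite_measure "lebesgue_on S"
    using assms by (intro finite_measure_lebesgue_on bounded_set_imp_lmeasurable)
  have "(\<lambda>x. \<Prod>i\<in>UNIV. x $ i ^ \<alpha> i) \<in> Linf (lebesgue_on S)" for \<alpha> :: "'n \<Rightarrow> nat"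
    using assms by (intro continuous_Linf_lebesgue_on) (auto intro!: continuous_intros)
  then obtain C where C: "C \<ge> 0" "\<And>c. AE x in lebesgue_on S.
      \<bar>\<Sum>\<alpha> | sum \<alpha> UNIV \<le> k. c \<alpha> * (\<Prod>i\<in>UNIV. x $ i ^ \<alpha> i)\<bar>
      \<le> C * (LINT y|lebesgue_on S. \<bar>\<Sum>\<alpha> | sum \<alpha> UNIV \<le> k. c \<alpha> * (\<Prod>i\<in>UNIV. y $ i ^ \<alpha> i)\<bar>)"
    using span_Linf_le_L1[OF finite_multi_indices[of k],
        of "\<lambda>\<alpha> x. \<Prod>i\<in>UNIV. x $ i ^ \<alpha> i"] by blast
  have "AE x in lebesgue_on S. \<bar>p x\<bar> \<le> C * (LINT y|lebesgue_on S. \<bar>p y\<bar>)" if p: "p \<in> polys k" for p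
  proof -
    obtain c where "p = (\<lambda>x. \<Sum>\<alpha> | sum \<alpha> UNIV \<le> k. c \<alpha> * (\<Prod>i\<in>UNIV. x $ i ^ \<alpha> i))"
      using p unfolding polys_def by blast
    then show ?thesis
      using C(2)[of c] by simp
  qed
  then show ?thesis
    using C(1) by blast
qed

text \<open>Rests on completeness of Lebesgue measure, used on the whole space after extension by
  zero.\<close>

lemma borel_measurable_lebesgue_on_AE:
  fixes f g :: "'a::euclidean_space \<Rightarrow> real"
  assumes "f \<in> borel_measurable (lebesgue_on S)" "S \<in> sets lebesgue"
    and "AE x in lebesgue_on S. f x = g x"
  shows "g \<in> borel_measurable (lebesgue_on S)"
proof -
  have "AE x in lebesgue. x \<in> S \<longrightarrow> f x = g x"
    using assms(2,3) by (simp add: AE_restrict_space_iff)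
  then have "AE x in lebesgue. (if x \<in> S then f x else 0) = (if x \<in> S then g x else 0)"
    by eventually_elim simp
  then have "(\<lambda>x. if x \<in> S then g x else 0) \<in> borel_measurable lebesgue"
    by (rule borel_measurable_AE[OF borel_measurable_if_I[OF assms(1,2)]])
  then show ?thesis
    by (rule borel_measurable_if_D)
qed

text \<open>The pieces of \<Omega> together with its complement form a countable measurable cover of
  the whole space, and the extension of \<open>f\<close> by zero is measurable on each member. The
  pieces may overlap.\<close>

lemma borel_measurable_lebesgue_on_Union:
  fixes f :: "'a::euclidean_space \<Rightarrow> real"
  assumes "countable \<T>" and "\<Omega> \<subseteq> \<Union>\<T>" and "\<Omega> \<in> sets lebesgue"
    and \<T>: "\<And>K. K \<in> \<T> \<Longrightarrow> K \<in> sets lebesgue"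
    and f: "\<And>K. K \<in> \<T> \<Longrightarrow> f \<in> borel_measurable (lebesgue_on (K \<inter> \<Omega>))"
  shows "f \<in> borel_measurable (lebesgue_on \<Omega>)"
proof (rule borel_measurable_if_D)
  show "(\<lambda>x. if x \<in> \<Omega> then f x else 0) \<in> borel_measurable lebesgue"
  proof (rule measurable_piecewise_restrict[where C = "insert (- \<Omega>) ((\<lambda>K. K \<inter> \<Omega>) ` \<T>)"])
    fix S assume "S \<in> insert (- \<Omega>) ((\<lambda>K. K \<inter> \<Omega>) ` \<T>)"
    then consider "S = - \<Omega>" | K where "K \<in> \<T>" "S = K \<inter> \<Omega>"
      by blast
    then show "(\<lambda>x. if x \<in> \<Omega> then f x else 0) \<in> borel_measurable (lebesgue_on S)"
    proof cases
      case 1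
      have "(\<lambda>x. 0 :: real) \<in> borel_measurable (lebesgue_on S)"
        by simp
      then show ?thesis
        using 1 by (subst measurable_cong[where g = "\<lambda>x. 0"]) auto
    next
      case 2
      then show ?thesis
        using f[of K] by (subst measurable_cong[where g = f]) auto
    qed
  qed (use assms in \<open>auto simp: Compl_in_sets_lebesgue\<close>)
qed

text \<open>This inverse inequality turns convergence in L2 into essentially uniform convergence.\<close>

lemma broken_polys_le_L2:
  fixes \<Omega> :: "(real^'n::finite) set"
  assumes "bounded \<Omega>" and \<Omega>: "\<Omega> \<in> sets lebesgue" and fin: "finite \<T>" and cover: "\<Omega> \<subseteq> \<Union>\<T>"
    and \<T>: "\<And>K. K \<in> \<T> \<Longrightarrow> K \<in> sets lebesgue"
  shows "\<exists>C. \<forall>f\<in>broken_polys \<Omega> \<T> k. f \<in> Linf (lebesgue_on \<Omega>) \<and>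
    (\<forall>l\<ge>0. (LINT x|lebesgue_on \<Omega>. (f x)\<^sup>2) \<le> l\<^sup>2 \<longrightarrow> (AE x in lebesgue_on \<Omega>. \<bar>f x\<bar> \<le> C * l))"
proof -
  interpret finite_measure "lebesgue_on \<Omega>"
    using assms by (intro finite_measure_lebesgue_on bounded_set_imp_lmeasurable)
  define \<mu> where "\<mu> = measure (lebesgue_on \<Omega>) (space (lebesgue_on \<Omega>))"
  have bdd: "bounded (K \<inter> \<Omega>)" for K
    using \<open>bounded \<Omega>\<close> by blast
  have meas: "K \<inter> \<Omega> \<in> sets lebesgue" if "K \<in> \<T>" for K
    using \<Omega> \<T>[OF that] by blast
  have "\<exists>C\<ge>0. \<forall>p\<in>polys k. AE x in lebesgue_on (K \<inter> \<Omega>).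
      \<bar>p x\<bar> \<le> C * (LINT y|lebesgue_on (K \<inter> \<Omega>). \<bar>p y\<bar>)" if "K \<in> \<T>" for K
    using polys_le_L1[OF bdd meas[OF that]] .
  then obtain C where C0: "\<And>K. K \<in> \<T> \<Longrightarrow> C K \<ge> 0"
    and C: "\<And>K p. K \<in> \<T> \<Longrightarrow> p \<in> polys k \<Longrightarrow> AE x in lebesgue_on (K \<inter> \<Omega>).
      \<bar>p x\<bar> \<le> C K * (LINT y|lebesgue_on (K \<inter> \<Omega>). \<bar>p y\<bar>)"
    by metis
  \<comment> \<open>Bounds on the elements combine into one on \<Omega>. Their sum serves in place
    of the maximum, as they are nonnegative. This is used first for mere boundedness of
    \<open>f\<close>, then for the bound in terms of \<open>l\<close>.\<close>
  have glue: "AE x in lebesgue_on \<Omega>. \<bar>f x\<bar> \<le> (\<Sum>K\<in>\<T>. B K)"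
    if "\<And>K. K \<in> \<T> \<Longrightarrow> AE x in lebesgue_on (K \<inter> \<Omega>). \<bar>f x\<bar> \<le> B K"
      and B: "\<And>K. K \<in> \<T> \<Longrightarrow> B K \<ge> 0" for f :: "real^'n \<Rightarrow> real" and B
  proof -
    have "AE x in lebesgue. x \<in> K \<inter> \<Omega> \<longrightarrow> \<bar>f x\<bar> \<le> B K" if "K \<in> \<T>" for K
      using that(1) \<open>\<And>K. K \<in> \<T> \<Longrightarrow> AE x in lebesgue_on (K \<inter> \<Omega>). \<bar>f x\<bar> \<le> B K\<close>[OF that] meas[OF that]
      by (simp add: AE_restrict_space_iff)
    then have "AE x in lebesgue. \<forall>K\<in>\<T>. x \<in> K \<inter> \<Omega> \<longrightarrow> \<bar>f x\<bar> \<le> B K"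
      using fin by (intro AE_finite_allI)
    then have "AE x in lebesgue. x \<in> \<Omega> \<longrightarrow> \<bar>f x\<bar> \<le> (\<Sum>K\<in>\<T>. B K)"
    proof eventually_elim
      case (elim x)
      show ?case
      proof
        assume "x \<in> \<Omega>"
        then obtain K where "K \<in> \<T>" "x \<in> K"
          using cover by blast
        then have "\<bar>f x\<bar> \<le> B K"
          using elim \<open>x \<in> \<Omega>\<close> by blast
        also have "B K \<le> (\<Sum>K\<in>\<T>. B K)"
          using \<open>K \<in> \<T>\<close> fin B by (intro member_le_sum) auto
        finally show "\<bar>f x\<bar> \<le> (\<Sum>K\<in>\<T>. B K)" .
      qed
    qed
    then show ?thesis
      using \<Omega> by (simp add: AE_restrict_space_iff)
  qed
  \<comment> \<open>The factor \<open>C K\<close> passes from the L1 norm to the essential supremum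
    on an element, and \<open>1 + \<mu>\<close> from the L2 to the L1 norm on \<Omega>. Both are
    independent of \<open>f\<close>.\<close>
  have "f \<in> Linf (lebesgue_on \<Omega>) \<and> (\<forall>l\<ge>0. (LINT x|lebesgue_on \<Omega>. (f x)\<^sup>2) \<le> l\<^sup>2 \<longrightarrow>
      (AE x in lebesgue_on \<Omega>. \<bar>f x\<bar> \<le> ((\<Sum>K\<in>\<T>. C K) * (1 + \<mu>)) * l))"
    if f: "f \<in> broken_polys \<Omega> \<T> k" for f
  proof -
    obtain p where p: "\<And>K. K \<in> \<T> \<Longrightarrow> p K \<in> polys k"
      and fp: "\<And>K. K \<in> \<T> \<Longrightarrow> AE x in lebesgue_on (K \<inter> \<Omega>). f x = p K x"
      using bchoice[of \<T> "\<lambda>K p. p \<in> polys k \<and> (AE x in lebesgue_on (K \<inter> \<Omega>). f x = p x)"] f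
      unfolding broken_polys_def by blast
    define I where "I K = (LINT y|lebesgue_on (K \<inter> \<Omega>). \<bar>p K y\<bar>)" for K
    have bound: "AE x in lebesgue_on (K \<inter> \<Omega>). \<bar>f x\<bar> \<le> C K * I K" if "K \<in> \<T>" for K
      using C[OF that p[OF that]] fp[OF that] unfolding I_def by eventually_elim simp
    \<comment> \<open>Membership in \<open>broken_polys\<close> describes \<open>f\<close> only up
      to null sets, so even measurability has to be derived, element by element.\<close>
    have "f \<in> borel_measurable (lebesgue_on (K \<inter> \<Omega>))" if K: "K \<in> \<T>" for K
    proof (rule borel_measurable_lebesgue_on_AE)
      show "p K \<in> borel_measurable (lebesgue_on (K \<inter> \<Omega>))"
        by (intro Linf_measurable polys_Linf[OF p[OF K]] bdd meas K)
      show "AE x in lebesgue_on (K \<inter> \<Omega>). p K x = f x"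
        using fp[OF K] by eventually_elim simp
    qed (rule meas[OF K])
    then have "f \<in> borel_measurable (lebesgue_on \<Omega>)"
      using borel_measurable_lebesgue_on_Union[OF countable_finite[OF fin] cover \<Omega> \<T>] by blast
    moreover have "AE x in lebesgue_on \<Omega>. \<bar>f x\<bar> \<le> (\<Sum>K\<in>\<T>. C K * I K)"
      using bound C0 by (intro glue) (auto simp: I_def)
    ultimately have fL: "f \<in> Linf (lebesgue_on \<Omega>)"
      by (rule LinfI)
    moreover have "AE x in lebesgue_on \<Omega>. \<bar>f x\<bar> \<le> ((\<Sum>K\<in>\<T>. C K) * (1 + \<mu>)) * l"
      if "l \<ge> 0" and l: "(LINT x|lebesgue_on \<Omega>. (f x)\<^sup>2) \<le> l\<^sup>2" for l
    proof -
      have "I K \<le> (1 + \<mu>) * l" if K: "K \<in> \<T>" for K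
      proof -
        have "I K \<le> (LINT x|lebesgue_on \<Omega>. \<bar>f x\<bar>)"
          unfolding I_def
        proof (rule integral_mono_lebesgue_on_AE)
          show "integrable (lebesgue_on \<Omega>) (\<lambda>x. \<bar>f x\<bar>)"
            by (intro integrable_Linf Linf_abs fL)
          show "AE x in lebesgue_on (K \<inter> \<Omega>). \<bar>p K x\<bar> \<le> \<bar>f x\<bar>"
            using fp[OF K] by eventually_elim simp
        qed (use \<Omega> meas[OF K] in auto)
        also have "\<dots> \<le> (1 + \<mu>) * l"
          unfolding \<mu>_def by (rule integral_abs_le_L2[OF fL \<open>l \<ge> 0\<close> l])
        finally show ?thesis .
      qed
      then have "C K * I K \<le> C K * ((1 + \<mu>) * l)" if "K \<in> \<T>" for K
        using that C0 by (intro mult_left_mono) auto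
      then have "AE x in lebesgue_on (K \<inter> \<Omega>). \<bar>f x\<bar> \<le> C K * ((1 + \<mu>) * l)" if "K \<in> \<T>" for K
        using bound[OF that] that by (auto elim!: eventually_mono intro: order_trans)
      then have "AE x in lebesgue_on \<Omega>. \<bar>f x\<bar> \<le> (\<Sum>K\<in>\<T>. C K * ((1 + \<mu>) * l))"
        using C0 \<open>l \<ge> 0\<close> by (intro glue) (auto simp: \<mu>_def)
      then show ?thesis
        by (simp add: sum_distrib_right mult.assoc)
    qed
    ultimately show ?thesis
      by blast
  qed
  then show ?thesis
    by blast
qed

section \<open>Essentially uniform derivatives\<close>

text \<open>Differentiability at \<open>t\<close> in the essential supremum norm, with the division
  by \<open>s - t\<close> cleared. The exceptional null set may depend on \<open>s\<close>, and
  \<open>u'\<close> is the derivative at the single time \<open>t\<close>.\<close>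

definition ess_deriv ::
  "'a measure \<Rightarrow> (real \<Rightarrow> 'a \<Rightarrow> real) \<Rightarrow> ('a \<Rightarrow> real) \<Rightarrow> real \<Rightarrow> real set \<Rightarrow> bool" where
  "ess_deriv M u u' t S \<longleftrightarrow> t \<in> S \<and> (\<forall>s\<in>S. u s \<in> Linf M) \<and> u' \<in> Linf M \<and>
     (\<forall>e>0. \<forall>\<^sub>F s in at t within S. AE x in M. \<bar>u s x - u t x - (s - t) * u' x\<bar> \<le> e * \<bar>s - t\<bar>)"

section \<open>Sum and product rules for essential derivatives\<close>

lemma ess_deriv_const: "t \<in> S \<Longrightarrow> ess_deriv M (\<lambda>s x. c) (\<lambda>x. 0) t S"
  by (simp add: ess_deriv_def Linf_const)

lemma ess_deriv_add:
  assumes u: "ess_deriv M u u' t S" and w: "ess_deriv M w w' t S"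
  shows "ess_deriv M (\<lambda>s x. u s x + w s x) (\<lambda>x. u' x + w' x) t S"
  unfolding ess_deriv_def
proof (intro conjI ballI allI impI)
  fix e :: real assume "e > 0"
  then have "\<forall>\<^sub>F s in at t within S. AE x in M. \<bar>u s x - u t x - (s - t) * u' x\<bar> \<le> e / 2 * \<bar>s - t\<bar>"
    "\<forall>\<^sub>F s in at t within S. AE x in M. \<bar>w s x - w t x - (s - t) * w' x\<bar> \<le> e / 2 * \<bar>s - t\<bar>"
    using u w unfolding ess_deriv_def by (meson half_gt_zero)+
  then show "\<forall>\<^sub>F s in at t within S.
      AE x in M. \<bar>u s x + w s x - (u t x + w t x) - (s - t) * (u' x + w' x)\<bar> \<le> e * \<bar>s - t\<bar>"
  proof eventually_elim
    case (elim s)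
    then show ?case
      by eventually_elim (unfold distrib_left, linarith)
  qed
qed (use u w in \<open>auto simp: ess_deriv_def intro: Linf_add\<close>)

lemma ess_deriv_sum:
  "t \<in> S \<Longrightarrow> (\<And>i. i \<in> I \<Longrightarrow> ess_deriv M (u i) (u' i) t S) \<Longrightarrow>
    ess_deriv M (\<lambda>s x. \<Sum>i\<in>I. u i s x) (\<lambda>x. \<Sum>i\<in>I. u' i x) t S"
  by (induction I rule: infinite_finite_induct) (auto intro: ess_deriv_add ess_deriv_const)

text \<open>The pointwise core of the product rule. The two mixed terms are of size
  \<epsilon>|\<delta>|. The product of the two increments is of size |\<delta>|^2, and one factor
  |\<delta>| is traded for \<epsilon>.\<close>

lemma product_remainder_le:
  fixes u0 w0 du dw ru rw \<delta> B \<epsilon> :: real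
  assumes "\<bar>u0\<bar> \<le> B" "\<bar>w0\<bar> \<le> B" "\<bar>du\<bar> \<le> B" "\<bar>dw\<bar> \<le> B"
    and "\<bar>ru\<bar> \<le> \<epsilon> * \<bar>\<delta>\<bar>" "\<bar>rw\<bar> \<le> \<epsilon> * \<bar>\<delta>\<bar>" "\<epsilon> \<le> 1" "\<bar>\<delta>\<bar> \<le> \<epsilon>"
  shows "\<bar>u0 * rw + w0 * ru + (\<delta> * du + ru) * (\<delta> * dw + rw)\<bar> \<le> \<epsilon> * (2 * B + (B + 1)\<^sup>2) * \<bar>\<delta>\<bar>"
proof -
  have "B \<ge> 0" "\<epsilon> \<ge> 0"
    using assms by linarith+
  have step: "\<bar>\<delta> * d + r\<bar> \<le> \<bar>\<delta>\<bar> * (B + 1)" if "\<bar>d\<bar> \<le> B" "\<bar>r\<bar> \<le> \<epsilon> * \<bar>\<delta>\<bar>" for d r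
  proof -
    have "\<bar>\<delta> * d\<bar> \<le> \<bar>\<delta>\<bar> * B"
      using that by (simp add: abs_mult mult_left_mono)
    moreover have "\<epsilon> * \<bar>\<delta>\<bar> \<le> \<bar>\<delta>\<bar>"
      using \<open>\<epsilon> \<le> 1\<close> by (simp add: mult_left_le_one_le \<open>\<epsilon> \<ge> 0\<close>)
    ultimately show ?thesis
      using that(2) abs_triangle_ineq[of "\<delta> * d" r] by (simp add: algebra_simps)
  qed
  have "\<bar>u0 * rw\<bar> \<le> B * (\<epsilon> * \<bar>\<delta>\<bar>)" "\<bar>w0 * ru\<bar> \<le> B * (\<epsilon> * \<bar>\<delta>\<bar>)"
    unfolding abs_mult using assms \<open>B \<ge> 0\<close> by (intro mult_mono; simp)+
  moreover have "\<bar>(\<delta> * du + ru) * (\<delta> * dw + rw)\<bar> \<le> (\<bar>\<delta>\<bar> * (B + 1)) * (\<bar>\<delta>\<bar> * (B + 1))"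
    unfolding abs_mult using step assms \<open>B \<ge> 0\<close> by (intro mult_mono) auto
  moreover have "(\<bar>\<delta>\<bar> * (B + 1)) * (\<bar>\<delta>\<bar> * (B + 1)) \<le> \<epsilon> * (\<bar>\<delta>\<bar> * (B + 1)\<^sup>2)"
    using mult_right_mono[OF \<open>\<bar>\<delta>\<bar> \<le> \<epsilon>\<close>, of "\<bar>\<delta>\<bar> * (B + 1)\<^sup>2"]
    by (simp add: power2_eq_square mult_ac)
  ultimately have "\<bar>u0 * rw + w0 * ru + (\<delta> * du + ru) * (\<delta> * dw + rw)\<bar>
      \<le> B * (\<epsilon> * \<bar>\<delta>\<bar>) + B * (\<epsilon> * \<bar>\<delta>\<bar>) + \<epsilon> * (\<bar>\<delta>\<bar> * (B + 1)\<^sup>2)"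
    by linarith
  then show ?thesis
    by (simp add: algebra_simps)
qed

text \<open>Values and derivatives at \<open>t\<close> share an essential bound, so the remainder
  estimate for products applies at almost every point with one constant. This is how the cubic
  energy term becomes differentiable.\<close>

lemma ess_deriv_mult:
  assumes u: "ess_deriv M u u' t S" and w: "ess_deriv M w w' t S"
  shows "ess_deriv M (\<lambda>s x. u s x * w s x) (\<lambda>x. u' x * w t x + u t x * w' x) t S"
  unfolding ess_deriv_def
proof (intro conjI ballI allI impI)
  fix e :: real assume "e > 0"
  have L: "u t \<in> Linf M" "w t \<in> Linf M" "u' \<in> Linf M" "w' \<in> Linf M"
    using u w by (auto simp: ess_deriv_def)
  obtain B1 where B1: "AE x in M. \<bar>u t x\<bar> \<le> B1" by (rule LinfE[OF L(1)])
  obtain B2 where B2: "AE x in M. \<bar>w t x\<bar> \<le> B2" by (rule LinfE[OF L(2)])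
  obtain B3 where B3: "AE x in M. \<bar>u' x\<bar> \<le> B3" by (rule LinfE[OF L(3)])
  obtain B4 where B4: "AE x in M. \<bar>w' x\<bar> \<le> B4" by (rule LinfE[OF L(4)])
  \<comment> \<open>Including 0 secures \<open>B \<ge> 0\<close>, and with it
    \<open>N > 0\<close>.\<close>
  define B where "B = Max {0, B1, B2, B3, B4}"
  have "B \<ge> 0"
    by (simp add: B_def)
  define N where "N = 2 * B + (B + 1)\<^sup>2"
  have "N > 0"
    unfolding N_def using \<open>B \<ge> 0\<close> by (intro add_nonneg_pos) auto
  \<comment> \<open>Small enough for the total remainder,
    \<open>\<epsilon> * N * \<bar>s - t\<bar>\<close>, to stay below the target, and at most 1 as
    the remainder estimate demands.\<close>
  define \<epsilon> where "\<epsilon> = min 1 (e / N)"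
  have "\<epsilon> > 0" "\<epsilon> \<le> 1" and \<epsilon>N: "\<epsilon> * N \<le> e"
    using \<open>e > 0\<close> \<open>N > 0\<close> by (auto simp: \<epsilon>_def min_def field_simps)
  have near: "\<forall>\<^sub>F s in at t within S. \<bar>s - t\<bar> < \<epsilon>"
    using \<open>\<epsilon> > 0\<close> unfolding eventually_at dist_real_def by blast
  have "\<forall>\<^sub>F s in at t within S. AE x in M. \<bar>u s x - u t x - (s - t) * u' x\<bar> \<le> \<epsilon> * \<bar>s - t\<bar>"
    "\<forall>\<^sub>F s in at t within S. AE x in M. \<bar>w s x - w t x - (s - t) * w' x\<bar> \<le> \<epsilon> * \<bar>s - t\<bar>"
    using u w \<open>\<epsilon> > 0\<close> unfolding ess_deriv_def by blast+
  with near show "\<forall>\<^sub>F s in at t within S.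
      AE x in M. \<bar>u s x * w s x - u t x * w t x - (s - t) * (u' x * w t x + u t x * w' x)\<bar>
        \<le> e * \<bar>s - t\<bar>"
  proof eventually_elim
    case (elim s)
    from elim(2,3) B1 B2 B3 B4 show ?case
    proof eventually_elim
      case (elim x)
      define ru where "ru = u s x - u t x - (s - t) * u' x"
      define rw where "rw = w s x - w t x - (s - t) * w' x"
      have eq: "u s x * w s x - u t x * w t x - (s - t) * (u' x * w t x + u t x * w' x)
          = u t x * rw + w t x * ru + ((s - t) * u' x + ru) * ((s - t) * w' x + rw)"
        unfolding ru_def rw_def by (simp add: algebra_simps)
      have "B1 \<le> B" "B2 \<le> B" "B3 \<le> B" "B4 \<le> B"
        by (simp_all add: B_def)
      then have "\<bar>u t x * rw + w t x * ru + ((s - t) * u' x + ru) * ((s - t) * w' x + rw)\<bar>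
          \<le> \<epsilon> * N * \<bar>s - t\<bar>"
        unfolding N_def using elim \<open>\<bar>s - t\<bar> < \<epsilon>\<close> \<open>\<epsilon> \<le> 1\<close>
        by (intro product_remainder_le) (auto simp: ru_def rw_def)
      also have "\<dots> \<le> e * \<bar>s - t\<bar>"
        using \<epsilon>N by (intro mult_right_mono) auto
      finally show ?case
        unfolding eq .
    qed
  qed
qed (use u w in \<open>auto simp: ess_deriv_def intro!: Linf_intros\<close>)

lemma ess_deriv_cmult:
  assumes "ess_deriv M u u' t S"
  shows "ess_deriv M (\<lambda>s x. c * u s x) (\<lambda>x. c * u' x) t S"
proof -
  have "t \<in> S"
    using assms by (simp add: ess_deriv_def)
  from ess_deriv_mult[OF ess_deriv_const[OF this, of M c] assms] show ?thesis
    by simp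
qed

text \<open>Differentiation under the integral sign: the remainder is essentially uniformly small,
  so its integral over a finite measure is small as well.\<close>

lemma (in finite_measure) has_real_derivative_integral:
  assumes u: "ess_deriv M u u' t S"
  shows "((\<lambda>s. LINT x|M. u s x) has_real_derivative (LINT x|M. u' x)) (at t within S)"
  unfolding has_field_derivative_iff
proof (rule tendstoI)
  fix e :: real assume "e > 0"
  define \<mu> where "\<mu> = measure M (space M)"
  have "\<mu> \<ge> 0"
    by (simp add: \<mu>_def)
  have t: "t \<in> S" and L: "\<And>s. s \<in> S \<Longrightarrow> integrable M (u s)" "integrable M u'"
    using u by (auto simp: ess_deriv_def intro: integrable_Linf)
  \<comment> \<open>Adding 1 to \<open>\<mu>\<close> avoids division by zero for the null measure
    and makes \<open>\<mu> * \<epsilon> < e\<close> strict.\<close>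
  define \<epsilon> where "\<epsilon> = e / (\<mu> + 1)"
  have "\<epsilon> > 0"
    using \<open>e > 0\<close> \<open>\<mu> \<ge> 0\<close> by (simp add: \<epsilon>_def)
  then have "\<forall>\<^sub>F s in at t within S. AE x in M. \<bar>u s x - u t x - (s - t) * u' x\<bar> \<le> \<epsilon> * \<bar>s - t\<bar>"
    using u unfolding ess_deriv_def by blast
  moreover have "\<forall>\<^sub>F s in at t within S. s \<in> S \<and> s \<noteq> t"
    by (simp add: eventually_at_filter)
  ultimately show "\<forall>\<^sub>F s in at t within S.
      dist (((LINT x|M. u s x) - (LINT x|M. u t x)) / (s - t)) (LINT x|M. u' x) < e"
  proof eventually_elim
    case (elim s)
    have int: "integrable M (\<lambda>x. u s x - u t x - (s - t) * u' x)"
      using L t elim by auto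
    have "(LINT x|M. u s x) - (LINT x|M. u t x) - (s - t) * (LINT x|M. u' x)
        = (LINT x|M. u s x - u t x - (s - t) * u' x)"
      using L t elim by simp
    also have "\<bar>\<dots>\<bar> \<le> (LINT x|M. \<bar>u s x - u t x - (s - t) * u' x\<bar>)"
      using integral_norm_bound[of M "\<lambda>x. u s x - u t x - (s - t) * u' x"] by simp
    also have "\<dots> \<le> (LINT x|M. \<epsilon> * \<bar>s - t\<bar>)"
      using int elim by (intro integral_mono_AE) auto
    also have "\<dots> = \<mu> * \<epsilon> * \<bar>s - t\<bar>"
      by (simp add: \<mu>_def)
    also have "\<dots> < e * \<bar>s - t\<bar>"
      using \<open>e > 0\<close> \<open>\<mu> \<ge> 0\<close> elim by (simp add: \<epsilon>_def field_simps)
    finally have "\<bar>(LINT x|M. u s x) - (LINT x|M. u t x) - (s - t) * (LINT x|M. u' x)\<bar> / \<bar>s - t\<bar> < e"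
      using elim by (simp add: pos_divide_less_eq)
    moreover have "((LINT x|M. u s x) - (LINT x|M. u t x)) / (s - t) - (LINT x|M. u' x)
        = ((LINT x|M. u s x) - (LINT x|M. u t x) - (s - t) * (LINT x|M. u' x)) / (s - t)"
      using elim by (simp add: diff_divide_distrib)
    ultimately show ?case
      by (simp add: dist_real_def)
  qed
qed

text \<open>\<open>X\<close> stands for a space with an inverse inequality \<open>le\<close>, which
  converts the L2 error of the difference quotient into the essential bound \<open>C * l s\<close>.
  The error enters through a majorant \<open>l\<close>, so a component of a vector field can be
  measured by the norm of the whole field.\<close>

lemma ess_deriv_of_L2:
  assumes X: "\<And>f. f \<in> X \<Longrightarrow> f \<in> Linf M"
    and le: "\<And>f l. f \<in> X \<Longrightarrow> l \<ge> 0 \<Longrightarrow> (LINT x|M. (f x)\<^sup>2) \<le> l\<^sup>2 \<Longrightarrow> AE x in M. \<bar>f x\<bar> \<le> C * l"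
    and lincomb: "\<And>f g r s. f \<in> X \<Longrightarrow> g \<in> X \<Longrightarrow> (\<lambda>x. r * f x + s * g x) \<in> X"
    and t: "t \<in> S" and u: "\<And>s. s \<in> S \<Longrightarrow> u s \<in> X" and u': "u' \<in> X"
    and l0: "\<And>s. l s \<ge> 0"
    and l: "\<And>s. s \<in> S \<Longrightarrow> (LINT x|M. ((u s x - u t x) / (s - t) - u' x)\<^sup>2) \<le> (l s)\<^sup>2"
    and lim: "(l \<longlongrightarrow> 0) (at t within S)"
  shows "ess_deriv M u u' t S"
  unfolding ess_deriv_def
proof (intro conjI ballI allI impI)
  fix e :: real assume "e > 0"
  have "((\<lambda>s. C * l s) \<longlongrightarrow> 0) (at t within S)"
    using tendsto_mult_left[OF lim, of C] by simp
  then have "\<forall>\<^sub>F s in at t within S. C * l s < e"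
    using \<open>e > 0\<close> by (simp add: order_tendsto_iff)
  moreover have "\<forall>\<^sub>F s in at t within S. s \<in> S \<and> s \<noteq> t"
    by (simp add: eventually_at_filter)
  ultimately show "\<forall>\<^sub>F s in at t within S.
      AE x in M. \<bar>u s x - u t x - (s - t) * u' x\<bar> \<le> e * \<bar>s - t\<bar>"
  proof eventually_elim
    case (elim s)
    \<comment> \<open>The quotient error, spelled out as nested two-term combinations to match
      \<open>lincomb\<close>.\<close>
    have "(\<lambda>x. 1 / (s - t) * (1 * u s x + (- 1) * u t x) + (- 1) * u' x) \<in> X"
      using elim t by (intro lincomb u u') auto
    then have "(\<lambda>x. (u s x - u t x) / (s - t) - u' x) \<in> X"
      by simp
    from le[OF this l0 l] elim have "AE x in M. \<bar>(u s x - u t x) / (s - t) - u' x\<bar> \<le> C * l s"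
      by blast
    then show ?case
    proof eventually_elim
      case (elim x)
      then have "\<bar>(u s x - u t x) / (s - t) - u' x\<bar> * \<bar>s - t\<bar> \<le> e * \<bar>s - t\<bar>"
        using \<open>C * l s < e\<close> by (intro mult_right_mono) auto
      moreover have "((u s x - u t x) / (s - t) - u' x) * (s - t) = u s x - u t x - (s - t) * u' x"
        using \<open>s \<in> S \<and> s \<noteq> t\<close> by (simp add: field_simps)
      ultimately show ?case
        by (metis abs_mult)
    qed
  qed
qed (use t X u u' in auto)

section \<open>The discrete energy balance\<close>

lemma L2_inner_commute: "L2_inner \<Omega> f g = L2_inner \<Omega> g f"
  by (simp add: L2_inner_def inner_commute)

lemma L2_norm_square: "(L2_norm \<Omega> f)\<^sup>2 = L2_inner \<Omega> f f"
  by (simp add: L2_norm_def L2_inner_def)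

text \<open>Convergence of the velocity is given in the vector norm, whereas essential derivatives
  are taken of its components; this supplies the majorant connecting the two.\<close>

lemma L2_component_le:
  fixes w :: "'a::euclidean_space \<Rightarrow> real^'n::finite"
  assumes "finite_measure (lebesgue_on \<Omega>)" and w: "\<And>i. (\<lambda>x. w x $ i) \<in> Linf (lebesgue_on \<Omega>)"
  shows "(LINT x|lebesgue_on \<Omega>. (w x $ i)\<^sup>2) \<le> (L2_norm \<Omega> w)\<^sup>2"
proof -
  interpret finite_measure "lebesgue_on \<Omega>" by fact
  have "(LINT x|lebesgue_on \<Omega>. (w x $ i)\<^sup>2) \<le> (LINT x|lebesgue_on \<Omega>. (\<Sum>j\<in>UNIV. w x $ j * w x $ j))"
  proof (rule integral_mono)
    show "integrable (lebesgue_on \<Omega>) (\<lambda>x. (w x $ i)\<^sup>2)"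
      unfolding power2_eq_square by (intro integrable_Linf Linf_mult w)
    show "integrable (lebesgue_on \<Omega>) (\<lambda>x. \<Sum>j\<in>UNIV. w x $ j * w x $ j)"
      by (intro integrable_Linf Linf_sum Linf_mult w)
    show "(w x $ i)\<^sup>2 \<le> (\<Sum>j\<in>UNIV. w x $ j * w x $ j)" for x
      unfolding power2_eq_square by (rule member_le_sum) auto
  qed
  also have "\<dots> = (L2_norm \<Omega> w)\<^sup>2"
    by (simp add: L2_norm_square L2_inner_def inner_vec_def)
  finally show ?thesis .
qed

text \<open>The energy density is a polynomial in \<open>h\<close> and the components of
  \<open>v\<close>, so the sum and product rules apply. Differentiating h^2/2 - a h^3/3 gives (1 - a
  h) h' h, which is where the weight in the second equation of the scheme comes from.\<close>

lemma has_real_derivative_Hamiltonian: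
  fixes v :: "real \<Rightarrow> real^'n::finite \<Rightarrow> real^'n"
  assumes fin: "finite_measure (lebesgue_on \<Omega>)"
    and v: "\<And>i. ess_deriv (lebesgue_on \<Omega>) (\<lambda>s x. v s x $ i) (\<lambda>x. v' x $ i) t S"
    and h: "ess_deriv (lebesgue_on \<Omega>) h h' t S"
  shows "((\<lambda>s. Hamiltonian \<Omega> a (v s) (h s)) has_real_derivative
    L2_inner \<Omega> v' (v t) + L2_inner \<Omega> (\<lambda>x. (1 - a * h t x) * h' x) (h t)) (at t within S)"
proof -
  let ?M = "lebesgue_on \<Omega>"
  interpret finite_measure ?M by fact
  define E where "E s x = (\<Sum>i\<in>UNIV. 1/2 * (v s x $ i * v s x $ i))
    + (1/2 * (h s x * h s x) + (- a/3) * (h s x * (h s x * h s x)))" for s x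
  define E' where "E' x = (\<Sum>i\<in>UNIV. 1/2 * (v' x $ i * v t x $ i + v t x $ i * v' x $ i))
    + (1/2 * (h' x * h t x + h t x * h' x)
      + (- a/3) * (h' x * (h t x * h t x) + h t x * (h' x * h t x + h t x * h' x)))" for x
  have t: "t \<in> S" and hL: "h t \<in> Linf ?M" "h' \<in> Linf ?M"
    using h by (auto simp: ess_deriv_def)
  have vL: "(\<lambda>x. v t x $ i) \<in> Linf ?M" "(\<lambda>x. v' x $ i) \<in> Linf ?M" for i
    using v[of i] by (auto simp: ess_deriv_def)
  have "ess_deriv ?M E E' t S"
    unfolding E_def E'_def
    by (intro ess_deriv_add ess_deriv_sum ess_deriv_cmult ess_deriv_mult t v h)
  then have "((\<lambda>s. LINT x|?M. E s x) has_real_derivative (LINT x|?M. E' x)) (at t within S)"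
    by (rule has_real_derivative_integral)
  moreover have "Hamiltonian \<Omega> a (v s) (h s) = (LINT x|?M. E s x)" for s
  proof -
    have norm: "1/2 * (norm (v s x))\<^sup>2 = (\<Sum>i\<in>UNIV. 1/2 * (v s x $ i * v s x $ i))" for x
      by (simp add: power2_norm_eq_inner inner_vec_def sum_divide_distrib)
    show ?thesis
      unfolding Hamiltonian_def E_def norm
      by (simp add: power2_eq_square power3_eq_cube mult.assoc add_diff_eq)
  qed
  moreover have "(LINT x|?M. E' x) =
      L2_inner \<Omega> v' (v t) + L2_inner \<Omega> (\<lambda>x. (1 - a * h t x) * h' x) (h t)"
  proof -
    have "(\<lambda>x. v' x \<bullet> v t x) \<in> Linf ?M"
      unfolding inner_vec_def inner_real_def by (intro Linf_intros vL)
    moreover have "(\<lambda>x. ((1 - a * h t x) * h' x) \<bullet> h t x) \<in> Linf ?M"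
      unfolding inner_real_def by (intro Linf_intros hL)
    moreover have "E' x = v' x \<bullet> v t x + ((1 - a * h t x) * h' x) \<bullet> h t x" for x
    proof -
      have "(\<Sum>i\<in>UNIV. 1/2 * (v' x $ i * v t x $ i + v t x $ i * v' x $ i)) = v' x \<bullet> v t x"
        unfolding inner_vec_def by (intro sum.cong) auto
      then show ?thesis
        unfolding E'_def by (simp add: algebra_simps)
    qed
    ultimately show ?thesis
      unfolding L2_inner_def by (simp add: integrable_Linf)
  qed
  ultimately show ?thesis
    by simp
qed

theorem proposition5:
  fixes T a b c d :: real
    and k :: nat
    and \<Omega> :: "(real^'n::finite) set"
    and \<T> :: "(real^'n) set set"
    and v v' :: "real \<Rightarrow> real^'n \<Rightarrow> real^'n"
    and h h' :: "real \<Rightarrow> real^'n \<Rightarrow> real"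
    and v0 :: "real^'n \<Rightarrow> real^'n"
    and h0 :: "real^'n \<Rightarrow> real"
  assumes "T > 0" and "a \<ge> 0" and "c \<ge> 0" and "d \<ge> 0" and "b > 0"
    and "CARD('n) \<le> 3"
    and "open \<Omega>" and "connected \<Omega>" and "\<Omega> \<noteq> {}" and "bounded \<Omega>"
    and "conforming_simplicial_mesh \<Omega> \<T>"
    and "v0 \<in> Vh \<Omega> \<T> k" and "h0 \<in> Hh \<Omega> \<T> k"
    and "has_C1_derivative \<Omega> T (Vh \<Omega> \<T> k) v v'"
    and "has_C1_derivative \<Omega> T (Hh \<Omega> \<T> k) h h'"
    and "AE x in lebesgue_on \<Omega>. v 0 x = v0 x"
    and "AE x in lebesgue_on \<Omega>. h 0 x = h0 x"
    and "\<And>t w. t \<in> {0..T} \<Longrightarrow> w \<in> Vh \<Omega> \<T> k \<Longrightarrow>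
           L2_inner \<Omega> (v' t) w + L2_inner \<Omega> (weak_grad \<Omega> (h t)) w = 0"
    and "\<And>t q. t \<in> {0..T} \<Longrightarrow> q \<in> Hh \<Omega> \<T> k \<Longrightarrow>
           L2_inner \<Omega> (\<lambda>x. (1 - a * h t x) * h' t x) q - L2_inner \<Omega> (v t) (weak_grad \<Omega> q)
           = - b * L2_inner \<Omega> (weak_grad \<Omega> (h t)) (weak_grad \<Omega> q)
             - (c - d) * L2_inner \<Omega> (\<lambda>x. v t x \<bullet> weak_grad \<Omega> (h t) x) q
             + d * L2_inner \<Omega> (h t) (\<lambda>x. v t x \<bullet> weak_grad \<Omega> q x)"
  shows "(\<forall>t\<in>{0..T}. ((\<lambda>s. Hamiltonian \<Omega> a (v s) (h s)) has_real_derivative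
            - b * (L2_norm \<Omega> (weak_grad \<Omega> (h t)))\<^sup>2
            + (2 * d - c) * L2_inner \<Omega> (\<lambda>x. v t x \<bullet> weak_grad \<Omega> (h t) x) (h t))
            (at t within {0..T}))
         \<and> (c = 2 * d \<longrightarrow> antimono_on {0..T} (\<lambda>t. Hamiltonian \<Omega> a (v t) (h t)))"
proof -
  let ?M = "lebesgue_on \<Omega>" and ?S = "{0..T}"
  let ?H = "\<lambda>s. Hamiltonian \<Omega> a (v s) (h s)"
  define D where "D t = - b * (L2_norm \<Omega> (weak_grad \<Omega> (h t)))\<^sup>2
    + (2 * d - c) * L2_inner \<Omega> (\<lambda>x. v t x \<bullet> weak_grad \<Omega> (h t) x) (h t)" for t
  note bounded = \<open>bounded \<Omega>\<close> and mesh = \<open>conforming_simplicial_mesh \<Omega> \<T>\<close>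
    and C1 = \<open>has_C1_derivative \<Omega> T (Vh \<Omega> \<T> k) v v'\<close> \<open>has_C1_derivative \<Omega> T (Hh \<Omega> \<T> k) h h'\<close>
  have \<Omega>: "\<Omega> \<in> sets lebesgue"
    using \<open>open \<Omega>\<close> by simp
  have fin_M: "finite_measure ?M"
    using bounded \<Omega> by (intro finite_measure_lebesgue_on bounded_set_imp_lmeasurable)
  have "finite \<T>" "\<Omega> \<subseteq> \<Union>\<T>" "\<And>K. K \<in> \<T> \<Longrightarrow> K \<in> sets lebesgue"
    using mesh closure_subset[of \<Omega>]
    by (auto simp: conforming_simplicial_mesh_def triangulation_def
        dest!: bspec compact_simplex intro: lmeasurable_compact fmeasurableD)
  note inverse = broken_polys_le_L2[OF bounded \<Omega> this]
  obtain Cv where Cv: "\<And>f. f \<in> broken_polys \<Omega> \<T> k \<Longrightarrow> f \<in> Linf ?M"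
    "\<And>f l. f \<in> broken_polys \<Omega> \<T> k \<Longrightarrow> l \<ge> 0 \<Longrightarrow> (LINT x|?M. (f x)\<^sup>2) \<le> l\<^sup>2 \<Longrightarrow>
      AE x in ?M. \<bar>f x\<bar> \<le> Cv * l"
    using inverse[of k] by blast
  obtain Ch where Ch: "\<And>f. f \<in> broken_polys \<Omega> \<T> (k + 1) \<Longrightarrow> f \<in> Linf ?M"
    "\<And>f l. f \<in> broken_polys \<Omega> \<T> (k + 1) \<Longrightarrow> l \<ge> 0 \<Longrightarrow> (LINT x|?M. (f x)\<^sup>2) \<le> l\<^sup>2 \<Longrightarrow>
      AE x in ?M. \<bar>f x\<bar> \<le> Ch * l"
    using inverse[of "k + 1"] by blast
  have V: "v t \<in> Vh \<Omega> \<T> k" "v' t \<in> Vh \<Omega> \<T> k" and H: "h t \<in> Hh \<Omega> \<T> k" "h' t \<in> Hh \<Omega> \<T> k"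
    if "t \<in> ?S" for t
    using C1 that unfolding has_C1_derivative_def by blast+
  then have vi: "(\<lambda>x. v t x $ i) \<in> broken_polys \<Omega> \<T> k" "(\<lambda>x. v' t x $ i) \<in> broken_polys \<Omega> \<T> k"
    and hb: "h t \<in> broken_polys \<Omega> \<T> (k + 1)" "h' t \<in> broken_polys \<Omega> \<T> (k + 1)"
    if "t \<in> ?S" for t i
    using that unfolding Vh_def Hh_def by blast+
  have deriv: "(?H has_real_derivative D t) (at t within ?S)" if t: "t \<in> ?S" for t
  proof -
    define qv where "qv s x = (v s x - v t x) /\<^sub>R (s - t) - v' t x" for s x
    define qh where "qh s x = (h s x - h t x) /\<^sub>R (s - t) - h' t x" for s x
    have lim: "((\<lambda>s. L2_norm \<Omega> (qv s)) \<longlongrightarrow> 0) (at t within ?S)"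
      "((\<lambda>s. L2_norm \<Omega> (qh s)) \<longlongrightarrow> 0) (at t within ?S)"
      using C1 t unfolding has_C1_derivative_def qv_def qh_def by blast+
    have norm_nonneg: "L2_norm \<Omega> f \<ge> 0" for f :: "real^'n \<Rightarrow> 'b::euclidean_space"
      by (simp add: L2_norm_def L2_inner_def)
    have "ess_deriv ?M (\<lambda>s x. v s x $ i) (\<lambda>x. v' t x $ i) t ?S" for i
    proof (rule ess_deriv_of_L2[OF Cv broken_polys_lincomb t _ _ norm_nonneg _ lim(1)])
      fix s assume s: "s \<in> ?S"
      have "(\<lambda>x. qv s x $ j) \<in> Linf ?M" for j
        unfolding qv_def vector_minus_component vector_scaleR_component real_scaleR_def
        by (intro Linf_intros Cv(1) vi s t)
      moreover have "qv s x $ i = (v s x $ i - v t x $ i) / (s - t) - v' t x $ i" for x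
        by (simp add: qv_def divide_inverse mult.commute)
      ultimately
      show "(LINT x|?M. ((v s x $ i - v t x $ i) / (s - t) - v' t x $ i)\<^sup>2) \<le> (L2_norm \<Omega> (qv s))\<^sup>2"
        using L2_component_le[OF fin_M, of "qv s" i] by simp
    qed (use vi t in auto)
    moreover have "ess_deriv ?M h (h' t) t ?S"
    proof (rule ess_deriv_of_L2[OF Ch broken_polys_lincomb t _ _ norm_nonneg _ lim(2)])
      fix s assume "s \<in> ?S"
      show "(LINT x|?M. ((h s x - h t x) / (s - t) - h' t x)\<^sup>2) \<le> (L2_norm \<Omega> (qh s))\<^sup>2"
        unfolding L2_norm_square
        by (simp add: L2_inner_def qh_def divide_inverse mult.commute power2_eq_square)
    qed (use hb t in auto)
    ultimately have "(?H has_real_derivative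
        L2_inner \<Omega> (v' t) (v t) + L2_inner \<Omega> (\<lambda>x. (1 - a * h t x) * h' t x) (h t)) (at t within ?S)"
      by (rule has_real_derivative_Hamiltonian[OF fin_M])
    moreover have "L2_inner \<Omega> (v' t) (v t) + L2_inner \<Omega> (\<lambda>x. (1 - a * h t x) * h' t x) (h t) = D t"
      using assms(18)[OF t V(1)[OF t]] assms(19)[OF t H(1)[OF t]]
        L2_inner_commute[of \<Omega> "v t" "weak_grad \<Omega> (h t)"]
        L2_inner_commute[of \<Omega> "h t" "\<lambda>x. v t x \<bullet> weak_grad \<Omega> (h t) x"]
      by (simp add: D_def L2_norm_square algebra_simps)
    ultimately show ?thesis
      by simp
  qed
  moreover have "antimono_on ?S ?H" if "c = 2 * d"
  proof (rule monotone_onI)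
    fix x y assume xy: "x \<in> ?S" "y \<in> ?S" "x \<le> y"
    have "(?H has_derivative (*) (D z)) (at z within {x..y})" if "x \<le> z" "z \<le> y" for z
    proof -
      have "(?H has_real_derivative D z) (at z within {x..y})"
        using that xy by (intro has_field_derivative_subset[OF deriv]) auto
      then show ?thesis
        by (simp add: has_field_derivative_def)
    qed
    then obtain z where "?H y - ?H x = D z * (y - x)"
      using mvt_very_simple[OF \<open>x \<le> y\<close>, of ?H "\<lambda>z. (*) (D z)"] by blast
    moreover have "D z * (y - x) \<le> 0"
      using \<open>c = 2 * d\<close> \<open>b > 0\<close> \<open>x \<le> y\<close> by (simp add: D_def mult_nonpos_nonneg)
    ultimately show "?H y \<le> ?H x"
      by simp
  qed
  ultimately show ?thesis
    unfolding D_def by blast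
qed

end
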